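(* (1) For $k=2$, Approval Voting ($\mathit{AV}$) satisfies JR if ties are broken in favor of sets that provide JR: for every ballot profile $\vec{A}$ over a candidate set $C$ with $|C|\ge 2$, the committee output by $\mathit{AV}$ with such a tie-breaking rule on $(\vec{A},2)$ provides justified representation for $(\vec{A},2)$. (2) For every $k\ge 3$, $\mathit{AV}$ fails JR: there exist a candidate set $C$ and a ballot profile $\vec{A}$ such that the committee output by $\mathit{AV}$ on $(\vec{A},k)$ (whatever the tie-breaking rule) does not provide justified representation for $(\vec{A},k)$.
   Context: Setting. $N=\{1,\dots,n\}$ ($n\ge 1$) is a set of voters, $C$ is a finite set of candidates. Each voter $i\in N$ submits an approval ballot $A_i\subseteq C$; the list $\vec{A}=(A_1,\dots,A_n)$ is the ballot profile. An approval-based multi-winner rule takes $(N,C,\vec{A},k)$ with $1\le k\le|C|$ and returns a committee $W\subseteq C$ with $|W|=k$. Justified representation (JR). A set $W\subseteq C$ with $|W|=k$ provides justified representation for $(\vec{A},k)$ if there is no set of voters $N^*\subseteq N$ with $|N^*|\ge \frac{n}{k}$ such that $\bigcap_{i\in N^*}A_i\neq\emptyset$ and $A_i\cap W=\emptyset$ for all $i\in N^*$. $\mathit{AV}$ outputs a set $W\subseteq C$ of size $k$ that maximizes $\sum_{c\in W}|\{i\in N\mid c\in A_i\}|$. Ties among maximizing sets are broken by some deterministic procedure; ties are broken in favor of sets that provide JR if, whenever some maximizing set provides JR, the selected maximizing set provides JR. *)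

theory Defs
  imports Complex_Main
begin

text \<open>A ballot profile is the list of the voters' approval sets; the voters are the
  positions of this list, so they are numbered from \<open>0\<close> rather than from \<open>1\<close>.\<close>

type_synonym 'c profile = "'c set list"

definition voters :: "'c profile \<Rightarrow> nat set" where
  "voters A = {..<length A}"

definition election :: "'c set \<Rightarrow> 'c profile \<Rightarrow> nat \<Rightarrow> bool" where
  "election C A k \<longleftrightarrow>
     finite C \<and> length A \<ge> 1 \<and> (\<forall>i\<in>voters A. A ! i \<subseteq> C) \<and> 1 \<le> k \<and> k \<le> card C"

definition committee :: "'c set \<Rightarrow> nat \<Rightarrow> 'c set \<Rightarrow> bool" where
  "committee C k W \<longleftrightarrow> W \<subseteq> C \<and> card W = k"

text \<open>This is only meant for committees \<open>W\<close> of size \<open>k\<close>. As there is at least one voter and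
  \<open>k \<ge> 1\<close>, the set \<open>S\<close> below is never empty, so its intersection is the intended one.\<close>

definition provides_JR :: "'c profile \<Rightarrow> nat \<Rightarrow> 'c set \<Rightarrow> bool" where
  "provides_JR A k W \<longleftrightarrow>
     \<not> (\<exists>S \<subseteq> voters A. real (card S) \<ge> real (length A) / real k \<and>
          (\<Inter>i\<in>S. A ! i) \<noteq> {} \<and> (\<forall>i\<in>S. A ! i \<inter> W = {}))"

definition AV_score :: "'c profile \<Rightarrow> 'c set \<Rightarrow> nat" where
  "AV_score A W = (\<Sum>c\<in>W. card {i \<in> voters A. c \<in> A ! i})"

definition AV_maximizer :: "'c set \<Rightarrow> 'c profile \<Rightarrow> nat \<Rightarrow> 'c set \<Rightarrow> bool" where
  "AV_maximizer C A k W \<longleftrightarrow> is_arg_max (AV_score A) (committee C k) W"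

text \<open>A deterministic tie-breaking procedure amounts to a function that selects one of the
  maximizing committees in every election; its values outside of elections are irrelevant.\<close>

type_synonym 'c rule = "'c set \<Rightarrow> 'c profile \<Rightarrow> nat \<Rightarrow> 'c set"

definition AV_rule :: "'c rule \<Rightarrow> bool" where
  "AV_rule R \<longleftrightarrow> (\<forall>C A k. election C A k \<longrightarrow> AV_maximizer C A k (R C A k))"

definition ties_favor_JR :: "'c rule \<Rightarrow> bool" where
  "ties_favor_JR R \<longleftrightarrow>
     (\<forall>C A k. election C A k \<longrightarrow> (\<exists>W. AV_maximizer C A k W \<and> provides_JR A k W) \<longrightarrow>
        provides_JR A k (R C A k))"

lemma AV_maximizer_exists:
  assumes "election C A k"
  shows "\<exists>W. AV_maximizer C A k W"
proof -
  have fin: "finite {W. committee C k W}"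
    using assms by (auto simp: election_def committee_def intro: finite_subset[of _ "Pow C"])
  obtain W where W: "W \<subseteq> C" "card W = k"
    using assms obtain_subset_with_card_n[of k C] by (auto simp: election_def)
  hence ne: "AV_score A ` {W. committee C k W} \<noteq> {}"
    by (auto simp: committee_def)
  obtain V where V: "committee C k V" "AV_score A V = Max (AV_score A ` {W. committee C k W})"
    using Max_in[OF finite_imageI[OF fin] ne] by auto
  have "AV_score A W' \<le> AV_score A V" if "committee C k W'" for W'
    using that V(2) fin by (auto intro!: Max_ge)
  with V(1) show ?thesis
    by (auto simp: AV_maximizer_def is_arg_max_linorder)
qed

lemma AV_rule_favoring_JR_exists: "\<exists>R. AV_rule R \<and> ties_favor_JR R"
proof -
  define P where "P C A k W \<longleftrightarrow> AV_maximizer C A k W \<and>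
    ((\<exists>V. AV_maximizer C A k V \<and> provides_JR A k V) \<longrightarrow> provides_JR A k W)"
    for C :: "'a set" and A k W
  have "\<exists>W. P C A k W" if "election C A k" for C A k
    using AV_maximizer_exists[OF that] unfolding P_def by blast
  hence "\<exists>R. \<forall>C A k. election C A k \<longrightarrow> P C A k (R C A k)"
    by metis
  then obtain R where "\<And>C A k. election C A k \<Longrightarrow> P C A k (R C A k)"
    by blast
  hence "AV_rule R \<and> ties_favor_JR R"
    unfolding P_def AV_rule_def ties_favor_JR_def by blast
  thus ?thesis by blast
qed

end

theory Submission
  imports Defs
begin

text \<open>Exchanging one member of a maximizing committee for an outsider cannot raise the score, so
  every member has at least as many supporters as every outsider. For \<open>k = 2\<close>, suppose that half of
  the voters share a candidate \<open>c\<close> and are not represented by the selected \<open>{a, b}\<close>. Counting then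
  forces \<open>a\<close>, \<open>b\<close> and \<open>c\<close> to have equally many supporters and every other voter to approve \<open>b\<close>; so
  \<open>{b, c}\<close> is a maximizing committee as well, and it represents every voter. For \<open>k \<ge> 3\<close>, let one of
  \<open>k\<close> voters approve a private candidate only, and let the other \<open>k - 1 \<ge> 2\<close> voters all approve the
  same \<open>k\<close> other candidates.\<close>

definition supporters :: "'c profile \<Rightarrow> 'c \<Rightarrow> nat set" where
  "supporters A c = {i \<in> voters A. c \<in> A ! i}"

lemma finite_voters [simp]: "finite (voters A)"
  by (simp add: voters_def)

lemma card_voters [simp]: "card (voters A) = length A"
  by (simp add: voters_def)

lemma finite_supporters [simp]: "finite (supporters A c)"
  by (simp add: supporters_def)

text \<open>Stated additively because scores are natural numbers, where subtraction
  truncates.\<close>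

lemma AV_score_swap:
  assumes "finite W" "x \<in> W" "y \<notin> W"
  shows "AV_score A (insert y (W - {x})) + card (supporters A x) =
    AV_score A W + card (supporters A y)"
  using assms by (simp add: AV_score_def supporters_def sum.remove[of W x])

lemma committee_swap:
  assumes "finite C" "committee C k W" "x \<in> W" "y \<in> C - W"
  shows "committee C k (insert y (W - {x}))"
proof -
  have "finite W" using assms(1,2) by (auto simp: committee_def intro: finite_subset)
  with assms show ?thesis
    using card_Suc_Diff1[of W x] by (auto simp: committee_def)
qed

lemma AV_maximizer_card_supporters_le:
  assumes "finite C" "AV_maximizer C A k W" "x \<in> W" "y \<in> C - W"
  shows "card (supporters A y) \<le> card (supporters A x)"
proof -
  have com: "committee C k W" and max: "\<And>V. committee C k V \<Longrightarrow> AV_score A V \<le> AV_score A W"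
    using assms(2) by (auto simp: AV_maximizer_def is_arg_max_linorder)
  have "finite W" using assms(1) com by (auto simp: committee_def intro: finite_subset)
  with max[OF committee_swap[OF assms(1) com assms(3,4)]] AV_score_swap[of W x y A] assms(3,4)
  show ?thesis by simp
qed

lemma AV_maximizer_swap:
  assumes "finite C" "AV_maximizer C A k W" "x \<in> W" "y \<in> C - W"
    and "card (supporters A x) \<le> card (supporters A y)"
  shows "AV_maximizer C A k (insert y (W - {x}))"
proof -
  have com: "committee C k W" and max: "\<And>V. committee C k V \<Longrightarrow> AV_score A V \<le> AV_score A W"
    using assms(2) by (auto simp: AV_maximizer_def is_arg_max_linorder)
  have "finite W" using assms(1) com by (auto simp: committee_def intro: finite_subset)
  hence le: "AV_score A W \<le> AV_score A (insert y (W - {x}))"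
    using AV_score_swap[of W x y A] assms(3-5) by simp
  show ?thesis
    unfolding AV_maximizer_def is_arg_max_linorder
    using committee_swap[OF assms(1) com assms(3,4)] order_trans[OF max le] by simp
qed

text \<open>A violating group has at least n/k > 0 voters, so it would contain a voter, who is
  represented by assumption.\<close>

lemma provides_JR_if_all_represented:
  assumes "election C A k" "\<And>i. i \<in> voters A \<Longrightarrow> A ! i \<inter> W \<noteq> {}"
  shows "provides_JR A k W"
proof -
  have "real (length A) / real k > 0"
    using assms(1) by (intro divide_pos_pos) (auto simp: election_def)
  hence "S \<noteq> {}" if "real (card S) \<ge> real (length A) / real k" for S :: "nat set"
    using that by auto
  moreover have "S = {}" if "S \<subseteq> voters A" "\<forall>i\<in>S. A ! i \<inter> W = {}" for S
    using that assms(2) by blast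
  ultimately show ?thesis unfolding provides_JR_def by metis
qed

text \<open>Tie-breaking in favor of JR turns this existence into JR of the selected
  committee.\<close>

lemma AV_two_JR_maximizer_exists:
  assumes el: "election C A 2" and max: "AV_maximizer C A 2 W"
  shows "\<exists>V. AV_maximizer C A 2 V \<and> provides_JR A 2 V"
proof (cases "provides_JR A 2 W")
  case True
  with max show ?thesis by blast
next
  case False
  then obtain S where S: "S \<subseteq> voters A" "real (card S) \<ge> real (length A) / real 2"
    and common: "(\<Inter>i\<in>S. A ! i) \<noteq> {}" and unrep: "\<forall>i\<in>S. A ! i \<inter> W = {}"
    unfolding provides_JR_def not_not by (elim exE conjE)
  from common obtain c where c: "\<forall>i\<in>S. c \<in> A ! i" by auto
  have half: "length A \<le> 2 * card S" using S(2) by simp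
  have fin: "finite C" and "length A \<ge> 1" using el by (auto simp: election_def)
  have "S \<noteq> {}" using half \<open>length A \<ge> 1\<close> by auto
  then obtain i where i: "i \<in> S" by blast
  \<comment> \<open>Any voter in \<open>S\<close> approves \<open>c\<close>, but nobody in
    \<open>W\<close>.\<close>
  have cW: "c \<in> C - W"
    using i c unrep S(1) el unfolding election_def by blast
  have "W \<subseteq> C" "card W = 2"
    using max by (auto simp: AV_maximizer_def is_arg_max_linorder committee_def)
  then obtain a b where W: "W = {a, b}" "a \<noteq> b" by (meson card_2_iff)
  have card_diff: "card (voters A - S) \<le> card S"
    using half S(1) by (simp add: card_Diff_subset finite_subset[OF S(1)])
  have "S \<subseteq> supporters A c" using c S(1) by (auto simp: supporters_def)
  hence S_le: "card S \<le> card (supporters A c)" by (simp add: card_mono)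
  have sub: "supporters A x \<subseteq> voters A - S" if "x \<in> W" for x
    using that unrep by (auto simp: supporters_def)
  have le: "card (supporters A x) \<le> card (supporters A c)" if "x \<in> W" for x
    using card_mono[OF _ sub[OF that]] card_diff S_le by simp
  \<comment> \<open>The inclusion \<open>sub\<close> is an equality by size:
    |\<open>voters A - S\<close>| \<le> |\<open>S\<close>| \<le> |\<open>supporters A c\<close>|
    \<le> |\<open>supporters A x\<close>|, the last step by maximality of \<open>W\<close>.\<close>
  have eq: "supporters A x = voters A - S" if "x \<in> W" for x
    using AV_maximizer_card_supporters_le[OF fin max that cW] S_le card_diff
    by (intro card_seteq sub that) auto
  have bc: "insert c (W - {a}) = {b, c}" using W by auto
  have "AV_maximizer C A 2 {b, c}"
    using AV_maximizer_swap[OF fin max _ cW le, of a] W bc by simp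
  moreover have "provides_JR A 2 {b, c}"
  proof (rule provides_JR_if_all_represented[OF el])
    fix i assume "i \<in> voters A"
    thus "A ! i \<inter> {b, c} \<noteq> {}"
      using eq[of b] W c by (cases "i \<in> S") (auto simp: supporters_def)
  qed
  ultimately show ?thesis by blast
qed

text \<open>Voter 0 approves only candidate \<open>k\<close>. There are \<open>k + 1\<close>
  candidates, so a committee omits exactly one, and for a maximizer this must be
  \<open>k\<close>.\<close>

lemma AV_fails_JR:
  fixes k :: nat
  assumes "k \<ge> 3"
  defines "A \<equiv> {k} # replicate (k - 1) {..<k}"
  shows "election {..k} A k" and "AV_maximizer {..k} A k W \<Longrightarrow> \<not> provides_JR A k W"
proof -
  have len: "length A = k" using assms by simp
  have nth: "A ! i = (if i = 0 then {k} else {..<k})" if "i < k" for i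
    using that by (auto simp: A_def nth_Cons')
  show "election {..k} A k"
    using assms(1) len by (auto simp: election_def voters_def nth)
  assume max: "AV_maximizer {..k} A k W"
  hence W: "W \<subseteq> {..k}" "card W = k"
    by (auto simp: AV_maximizer_def is_arg_max_linorder committee_def)
  have "k \<notin> W"
  proof
    assume "k \<in> W"
    have "finite W" using W(1) finite_subset by blast
    hence "\<not> {..k} \<subseteq> W" using card_mono[of W "{..k}"] unfolding W(2) by auto
    then obtain j where j: "j \<in> {..k} - W" by blast
    with \<open>k \<in> W\<close> have "j < k" using nat_less_le by auto
    have "supporters A j = {1..<k}"
      using \<open>j < k\<close> by (auto simp: supporters_def voters_def len nth split: if_splits)
    moreover have "supporters A k = {0}"
      using assms(1) by (auto simp: supporters_def voters_def len nth split: if_splits)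
    \<comment> \<open>The outsider \<open>j\<close> has \<open>k - 1\<close> \<ge> 2 supporters and
      \<open>k\<close> has one; this strict gap leaves no room for tie-breaking.\<close>
    ultimately show False
      using AV_maximizer_card_supporters_le[OF _ max \<open>k \<in> W\<close> j] assms(1) by simp
  qed
  moreover have "A ! 0 = {k}" by (simp add: A_def)
  \<comment> \<open>With \<open>k\<close> voters the threshold n/k is 1, so voter 0 alone is a
    violating group.\<close>
  ultimately show "\<not> provides_JR A k W"
    unfolding provides_JR_def not_not using assms(1)
    by (intro exI[of _ "{0}"]) (auto simp: voters_def len)
qed

theorem theorem3:
  "(\<forall>R :: 'c rule. AV_rule R \<and> ties_favor_JR R \<longrightarrow>
      (\<forall>(C :: 'c set) A. election C A 2 \<longrightarrow> provides_JR A 2 (R C A 2))) \<and>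
   (\<forall>k\<ge>3. \<exists>(C :: nat set) A. election C A k \<and>
      (\<forall>R :: nat rule. AV_rule R \<longrightarrow> \<not> provides_JR A k (R C A k)))"
proof (intro conjI allI impI)
  fix R :: "'c rule" and C :: "'c set" and A
  assume R: "AV_rule R \<and> ties_favor_JR R" and el: "election C A 2"
  hence "AV_maximizer C A 2 (R C A 2)" by (simp add: AV_rule_def)
  with AV_two_JR_maximizer_exists[OF el] R el show "provides_JR A 2 (R C A 2)"
    by (simp add: ties_favor_JR_def)
next
  fix k :: nat
  assume k: "3 \<le> k"
  let ?A = "{k} # replicate (k - 1) {..<k}"
  have "\<not> provides_JR ?A k (R {..k} ?A k)" if "AV_rule R" for R
    using that AV_fails_JR[OF k] unfolding AV_rule_def by metis
  with AV_fails_JR(1)[OF k]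
  show "\<exists>(C :: nat set) A. election C A k \<and>
      (\<forall>R :: nat rule. AV_rule R \<longrightarrow> \<not> provides_JR A k (R C A k))"
    by (intro exI conjI allI impI)
qed

end
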